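(* Assume that $\lambda_{\min}(\boldsymbol{G}(\boldsymbol{\xi}))\ge\omega_{\min}$ for all $\boldsymbol{\xi}\in\mathbb{X}$ for some $\omega_{\min}>0$, that $\mathbb{X}$ is convex and compact, that $\mathcal{K}$ is differentiable with respect to $\boldsymbol{\xi}\in\mathbb{X}$, that there is $\rho>0$ such that $\mathcal{K}^{\mathrm{red}}$ is directionally convex in $\Lambda_\psi^\star(\rho)$, and that $\nabla\mathcal{K}^{\mathrm{red}}$ is Lipschitz continuous with constant $L^{\mathrm{red}}>0$, i.e. $\|\nabla\mathcal{K}^{\mathrm{red}}(\boldsymbol{\xi})-\nabla\mathcal{K}^{\mathrm{red}}(\boldsymbol{\eta})\|_{\mathbb{X},*}\le L^{\mathrm{red}}\|\boldsymbol{\xi}-\boldsymbol{\eta}\|_{\mathbb{X}}$ for all $\boldsymbol{\xi},\boldsymbol{\eta}\in\mathbb{X}$. Let $\boldsymbol{\xi}_0\in\Lambda_\psi^\star(\rho)$, and let $(\boldsymbol{\xi}_k)_{k\ge0}$ be the sequence produced by the alternating algorithm with exact updates of the linear parameters and step sizes $\gamma_k>0$ satisfying $\gamma_k\le\mu/L^{\mathrm{red}}$ for all $k\ge0$. Then: (1) $\delta_\psi^\star(\boldsymbol{\xi}_{k+1})\le\delta_\psi^\star(\boldsymbol{\xi}_k)$ for all $k\ge0$, so that $\boldsymbol{\xi}_k\in\Lambda_\psi^\star(\delta_\psi^\star(\boldsymbol{\xi}_0))$ for all $k\ge0$; (2) for all $n\ge1$, $$\mathcal{K}^{\mathrm{r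ed}}(\boldsymbol{\xi}_n)\le\mathcal{K}^\star+\frac{\delta_\psi^\star(\boldsymbol{\xi}_0)}{\sum_{k=0}^{n-1}\gamma_k}.$$
   Context: Setting. $U$ is a real Hilbert space; $a:U\times U\to\mathbb{R}$ is a symmetric, continuous bilinear form with $a(u,u)\ge\alpha\|u\|_U^2$ for some $\alpha>0$; $\ell:U\to\mathbb{R}$ is a continuous linear form. The energy is $\mathcal{J}(u)=\tfrac12a(u,u)-\ell(u)$. Let $\mathbb{W}=\mathbb{R}^{n_L}$ ($n_L\ge1$) and let $\mathbb{X}\subset\mathbb{R}^{n_{NL}}$ be closed and nonempty. Given basis functions $\boldsymbol{\phi}=(\boldsymbol{\phi}_1,\dots,\boldsymbol{\phi}_{n_L}):\mathbb{X}\to U^{n_L}$, put $\mathcal{R}(\boldsymbol{w},\boldsymbol{\xi})=\sum_k\boldsymbol{w}_k\boldsymbol{\phi}_k(\boldsymbol{\xi})$ and $\mathcal{K}(\boldsymbol{w},\boldsymbol{\xi})=\mathcal{J}(\mathcal{R}(\boldsymbol{w},\boldsymbol{\xi}))=\tfrac12\boldsymbol{w}^{*}\boldsymbol{A}(\boldsymbol{\xi})\boldsymbol{w}-\boldsymbol{w}^{*}\boldsymbol{\ell}(\boldsymbol{\xi})$, with $\boldsymbol{A}(\boldsymbol{\xi})_{ij}=a(\boldsymbol{\phi}_j(\boldsymbol{\xi}),\boldsymbol{\phi}_i(\boldsymbol{\xi}))$, $\boldsymbol{\ell}(\boldsymbol{\xi})_j=\ell(\boldsymbol{\phi}_j(\boldsymbol{\xi}))$.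 The Gram matrix is $\boldsymbol{G}(\boldsymbol{\xi})_{ij}=(\boldsymbol{\phi}_j(\boldsymbol{\xi}),\boldsymbol{\phi}_i(\boldsymbol{\xi}))_U$, and $\lambda_{\min}$ denotes the smallest eigenvalue. When $\lambda_{\min}(\boldsymbol{G}(\boldsymbol{\xi}))\ge\omega_{\min}>0$, $\boldsymbol{A}(\boldsymbol{\xi})$ is positive definite and one sets $\boldsymbol{w}^{\mathrm{best}}(\boldsymbol{\xi})=\boldsymbol{A}(\boldsymbol{\xi})^{-1}\boldsymbol{\ell}(\boldsymbol{\xi})$ and the reduced energy $\mathcal{K}^{\mathrm{red}}(\boldsymbol{\xi})=\mathcal{K}(\boldsymbol{w}^{\mathrm{best}}(\boldsymbol{\xi}),\boldsymbol{\xi})$. Moreover $\mathcal{K}^\star=\min_{\mathbb{W}\times\mathbb{X}}\mathcal{K}=\min_{\mathbb{X}}\mathcal{K}^{\mathrm{red}}$. Norms and mirror map. $\|\cdot\|_{\mathbb{X}}$ is a norm on $\mathbb{R}^{n_{NL}}$ induced by an inner product, with dual norm $\|\cdot\|_{\mathbb{X},*}$ and duality pairing $\langle\cdot,\cdot\rangle_{\mathbb{X}}$. $\psi:\mathbb{X}\to\mathbb{R}$ is twice differentiable and $\mu$-strongly convex ($\mu>0$): $\psi(\boldsymbol{\eta})\ge\psi(\boldsymbol{\xi})+\langle\nabla\psi(\boldsymbol{\xi}),\boldsymbol{\eta}-\boldsymbol{\xi}\rangle_{\mathbb{X}}+\tfrac{\mu}{2}\|\boldsymbol{\eta}-\boldsymbol{\xi}\|_{\mathbb{X}}^2$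 for all $\boldsymbol{\xi},\boldsymbol{\eta}\in\mathbb{X}$. (Differentiability of functions on $\mathbb{X}$ is understood on an open neighbourhood of $\mathbb{X}$.) The Bregman divergence is $D_\psi(\boldsymbol{\eta};\boldsymbol{\xi})=\psi(\boldsymbol{\eta})-\psi(\boldsymbol{\xi})-\langle\nabla\psi(\boldsymbol{\xi}),\boldsymbol{\eta}-\boldsymbol{\xi}\rangle_{\mathbb{X}}$. Algorithm with exact linear updates. $\boldsymbol{w}_k=\boldsymbol{w}^{\mathrm{best}}(\boldsymbol{\xi}_k)$ for all $k\ge 0$, and $\boldsymbol{\xi}_{k+1}\in\arg\min_{\boldsymbol{\eta}\in\mathbb{X}}\ \gamma_k\langle\nabla_{\mathbb{X}}\mathcal{K}(\boldsymbol{w}_k,\boldsymbol{\xi}_k),\boldsymbol{\eta}\rangle_{\mathbb{X}}+D_\psi(\boldsymbol{\eta};\boldsymbol{\xi}_k)$, where $\nabla_{\mathbb{X}}$ is the gradient with respect to $\boldsymbol{\xi}$ at fixed $\boldsymbol{w}$ (no stopping test). Best nonlinear parameters. $\mathbb{X}^\star=\{\boldsymbol{\xi}\in\mathbb{X}:\mathcal{K}^{\mathrm{red}}(\boldsymbol{\xi})=\mathcal{K}^\star\}$; $\delta_\psi^\star(\boldsymbol{\xi})=\inf_{\boldsymbol{\xi}^\star\in\mathbb{X}^\star}D_\psi(\boldsymbol{\xi}^\star;\boldsymbol{\xi})$; $\Pi_\psi^\star(\boldsymbol{\xi})\subset\mathbb{X}^\star$ is the set of $\boldsymbol{\xi}^\star\in\mathbb{X}^\star$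 attaining this infimum; $\Lambda_\psi^\star(\rho)=\{\boldsymbol{\xi}\in\mathbb{X}:\delta_\psi^\star(\boldsymbol{\xi})\le\rho\}$. $\mathcal{K}^{\mathrm{red}}$ is directionally convex in $S\subset\mathbb{X}$ if for all $\boldsymbol{\xi}\in S$ there exists $\boldsymbol{\xi}^\star\in\Pi_\psi^\star(\boldsymbol{\xi})$ such that $\mathcal{K}^{\mathrm{red}}$ is convex on the segment $[\boldsymbol{\xi},\boldsymbol{\xi}^\star]$. *)

theory Defs
  imports "HOL-Analysis.Analysis"
begin

text \<open>
  Gradients are coordinate vectors: the duality pairing between a gradient and a vector of
  \<open>real ^ 'n\<close> is the Euclidean product \<open>\<bullet>\<close>, whatever inner product induces the norm used to
  measure vectors.
\<close>

definition grad :: "('a::real_inner \<Rightarrow> real) \<Rightarrow> 'a \<Rightarrow> 'a" where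
  "grad f x = (THE D. GDERIV f x :> D)"

text \<open>
  Functions on \<open>X\<close> are total functions restricted to \<open>X\<close>. Differentiability, and hence \<open>grad\<close> at
  points of \<open>X\<close>, refers to an open neighbourhood of \<open>X\<close>, so that the values near \<open>X\<close> matter.
\<close>

definition differentiable_near ::
  "('a::real_normed_vector \<Rightarrow> 'b::real_normed_vector) \<Rightarrow> 'a set \<Rightarrow> bool" where
  "differentiable_near f X \<longleftrightarrow> (\<exists>N. open N \<and> X \<subseteq> N \<and> f differentiable_on N)"

definition twice_differentiable_near :: "('a::real_inner \<Rightarrow> real) \<Rightarrow> 'a set \<Rightarrow> bool" where
  "twice_differentiable_near f X \<longleftrightarrow>
     (\<exists>N. open N \<and> X \<subseteq> N \<and> f differentiable_on N \<and> grad f differentiable_on N)"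

definition is_inner_product :: "('a::real_vector \<Rightarrow> 'a \<Rightarrow> real) \<Rightarrow> bool" where
  "is_inner_product B \<longleftrightarrow>
     (\<forall>x. linear (B x)) \<and> (\<forall>x y. B x y = B y x) \<and> (\<forall>x. x \<noteq> 0 \<longrightarrow> 0 < B x x)"

definition ip_norm :: "('a \<Rightarrow> 'a \<Rightarrow> real) \<Rightarrow> 'a \<Rightarrow> real" where
  "ip_norm B x = sqrt (B x x)"

definition dual_norm :: "('a::real_inner \<Rightarrow> 'a \<Rightarrow> real) \<Rightarrow> 'a \<Rightarrow> real" where
  "dual_norm B g = (SUP v\<in>{v. ip_norm B v \<le> 1}. g \<bullet> v)"

text \<open>Only applied to symmetric matrices, which have a smallest (real) eigenvalue.\<close>

definition lambda_min :: "real ^ 'l ^ 'l \<Rightarrow> real" where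
  "lambda_min M = (LEAST c. \<exists>v. v \<noteq> 0 \<and> M *v v = c *\<^sub>R v)"

definition energy :: "('u \<Rightarrow> 'u \<Rightarrow> real) \<Rightarrow> ('u \<Rightarrow> real) \<Rightarrow> 'u \<Rightarrow> real" where
  "energy a l u = a u u / 2 - l u"

definition realization ::
  "('x \<Rightarrow> 'u::real_vector ^ 'l) \<Rightarrow> real ^ 'l \<Rightarrow> 'x \<Rightarrow> 'u" where
  "realization \<phi> w \<xi> = (\<Sum>k\<in>UNIV. (w $ k) *\<^sub>R (\<phi> \<xi> $ k))"

definition param_energy ::
  "('u::real_vector \<Rightarrow> 'u \<Rightarrow> real) \<Rightarrow> ('u \<Rightarrow> real) \<Rightarrow> ('x \<Rightarrow> 'u ^ 'l) \<Rightarrow> real ^ 'l \<Rightarrow> 'x \<Rightarrow> real" where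
  "param_energy a l \<phi> w \<xi> = energy a l (realization \<phi> w \<xi>)"

definition stiffness :: "('u \<Rightarrow> 'u \<Rightarrow> real) \<Rightarrow> ('x \<Rightarrow> 'u ^ 'l) \<Rightarrow> 'x \<Rightarrow> real ^ 'l ^ 'l" where
  "stiffness a \<phi> \<xi> = (\<chi> i j. a (\<phi> \<xi> $ j) (\<phi> \<xi> $ i))"

definition load :: "('u \<Rightarrow> real) \<Rightarrow> ('x \<Rightarrow> 'u ^ 'l) \<Rightarrow> 'x \<Rightarrow> real ^ 'l" where
  "load l \<phi> \<xi> = (\<chi> j. l (\<phi> \<xi> $ j))"

definition gram :: "('x \<Rightarrow> 'u::real_inner ^ 'l) \<Rightarrow> 'x \<Rightarrow> real ^ 'l ^ 'l" where
  "gram \<phi> \<xi> = (\<chi> i j. (\<phi> \<xi> $ j) \<bullet> (\<phi> \<xi> $ i))"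

definition w_best ::
  "('u \<Rightarrow> 'u \<Rightarrow> real) \<Rightarrow> ('u \<Rightarrow> real) \<Rightarrow> ('x \<Rightarrow> 'u ^ 'l) \<Rightarrow> 'x \<Rightarrow> real ^ 'l" where
  "w_best a l \<phi> \<xi> = matrix_inv (stiffness a \<phi> \<xi>) *v load l \<phi> \<xi>"

definition reduced_energy ::
  "('u::real_vector \<Rightarrow> 'u \<Rightarrow> real) \<Rightarrow> ('u \<Rightarrow> real) \<Rightarrow> ('x \<Rightarrow> 'u ^ 'l) \<Rightarrow> 'x \<Rightarrow> real" where
  "reduced_energy a l \<phi> \<xi> = param_energy a l \<phi> (w_best a l \<phi> \<xi>) \<xi>"

text \<open>
  An infimum, which is a minimum when \<open>X\<close> is compact and nonempty, the smallest eigenvalue of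
  the Gram matrix is bounded below by a positive constant on \<open>X\<close>, \<open>a\<close> is symmetric, continuous
  and coercive, \<open>l\<close> is continuous, and the parametric energy is differentiable in \<open>\<xi>\<close>.
\<close>

definition min_energy ::
  "('u::real_vector \<Rightarrow> 'u \<Rightarrow> real) \<Rightarrow> ('u \<Rightarrow> real) \<Rightarrow> ('x \<Rightarrow> 'u ^ 'l) \<Rightarrow> 'x set \<Rightarrow> real" where
  "min_energy a l \<phi> X = (INF (w, \<xi>)\<in>UNIV \<times> X. param_energy a l \<phi> w \<xi>)"

definition best_params ::
  "('u::real_vector \<Rightarrow> 'u \<Rightarrow> real) \<Rightarrow> ('u \<Rightarrow> real) \<Rightarrow> ('x \<Rightarrow> 'u ^ 'l) \<Rightarrow> 'x set \<Rightarrow> 'x set" where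
  "best_params a l \<phi> X = {\<xi> \<in> X. reduced_energy a l \<phi> \<xi> = min_energy a l \<phi> X}"

definition strongly_convex_wrt ::
  "('a::real_inner \<Rightarrow> 'a \<Rightarrow> real) \<Rightarrow> real \<Rightarrow> 'a set \<Rightarrow> ('a \<Rightarrow> real) \<Rightarrow> bool" where
  "strongly_convex_wrt B \<mu> X \<psi> \<longleftrightarrow>
     (\<forall>\<xi>\<in>X. \<forall>\<eta>\<in>X. \<psi> \<eta> \<ge> \<psi> \<xi> + grad \<psi> \<xi> \<bullet> (\<eta> - \<xi>) + \<mu> / 2 * (ip_norm B (\<eta> - \<xi>))\<^sup>2)"

definition bregman :: "('a::real_inner \<Rightarrow> real) \<Rightarrow> 'a \<Rightarrow> 'a \<Rightarrow> real" where
  "bregman \<psi> \<eta> \<xi> = \<psi> \<eta> - \<psi> \<xi> - grad \<psi> \<xi> \<bullet> (\<eta> - \<xi>)"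

text \<open>In the following, \<open>S\<close> is the set of minimisers onto which one projects.\<close>

definition bregman_dist :: "('a::real_inner \<Rightarrow> real) \<Rightarrow> 'a set \<Rightarrow> 'a \<Rightarrow> real" where
  "bregman_dist \<psi> S \<xi> = (INF s\<in>S. bregman \<psi> s \<xi>)"

definition bregman_proj :: "('a::real_inner \<Rightarrow> real) \<Rightarrow> 'a set \<Rightarrow> 'a \<Rightarrow> 'a set" where
  "bregman_proj \<psi> S \<xi> = {s \<in> S. bregman \<psi> s \<xi> = bregman_dist \<psi> S \<xi>}"

definition bregman_nbhd :: "('a::real_inner \<Rightarrow> real) \<Rightarrow> 'a set \<Rightarrow> 'a set \<Rightarrow> real \<Rightarrow> 'a set" where
  "bregman_nbhd \<psi> S X \<rho> = {\<xi> \<in> X. bregman_dist \<psi> S \<xi> \<le> \<rho>}"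

definition directionally_convex_on ::
  "('a::real_inner \<Rightarrow> real) \<Rightarrow> 'a set \<Rightarrow> ('a \<Rightarrow> real) \<Rightarrow> 'a set \<Rightarrow> bool" where
  "directionally_convex_on \<psi> S f T \<longleftrightarrow>
     (\<forall>\<xi>\<in>T. \<exists>s\<in>bregman_proj \<psi> S \<xi>. convex_on (closed_segment \<xi> s) f)"

lemma grad_eqI: "GDERIV f x :> D \<Longrightarrow> grad f x = D"
  unfolding grad_def
proof (rule the_equality)
  fix D' assume D: "GDERIV f x :> D" and D': "GDERIV f x :> D'"
  have "(\<lambda>h. h \<bullet> D') = (\<lambda>h. h \<bullet> D)"
    using D D' unfolding gderiv_def by (rule has_derivative_unique[rotated])
  then have "h \<bullet> D' = h \<bullet> D" for h by meson
  then show "D' = D" by (metis vector_eq_rdot inner_commute)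
qed

lemma param_energy_quadratic:
  fixes a :: "'u::real_normed_vector \<Rightarrow> 'u \<Rightarrow> real"
  assumes "bounded_bilinear a" and "bounded_linear l"
  shows "param_energy a l \<phi> w \<xi> = w \<bullet> (stiffness a \<phi> \<xi> *v w) / 2 - w \<bullet> load l \<phi> \<xi>"
proof -
  interpret a: bounded_bilinear a by fact
  interpret l: bounded_linear l by fact
  have "a (realization \<phi> w \<xi>) (realization \<phi> w \<xi>)
      = (\<Sum>i\<in>UNIV. \<Sum>j\<in>UNIV. w $ i * (w $ j * a (\<phi> \<xi> $ j) (\<phi> \<xi> $ i)))"
    by (simp add: realization_def a.sum_left a.sum_right a.scaleR_left a.scaleR_right sum_distrib_left)
  also have "\<dots> = w \<bullet> (stiffness a \<phi> \<xi> *v w)"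
    by (simp add: stiffness_def inner_vec_def matrix_vector_mult_def sum_distrib_left mult_ac)
  finally show ?thesis
    by (simp add: param_energy_def energy_def load_def inner_vec_def realization_def
        l.sum l.scaleR)
qed

end

theory Submission
  imports Defs
begin

text \<open>
  With exact linear updates, the algorithm is mirror descent for the reduced energy alone. This
  is an envelope property: \<open>w_best\<close> minimises the energy in the linear parameters, so the
  variation of \<open>w_best\<close> with \<open>\<xi>\<close> contributes nothing to first order, and the gradient of the
  reduced energy is the partial gradient in \<open>\<xi>\<close> that the algorithm uses
  (\<open>GDERIV_reduced_energy\<close>). No derivative of the matrix inverse is computed. Freezing the
  linear parameters at \<open>w_best x\<close> gives a function of \<open>y\<close> that, near \<open>x\<close>, lies above the
  reduced energy, touches it at \<open>x\<close>, and exceeds it by half the quadratic form of the inverse stiffness matrix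
  at the residual of the linear system. The residual is \<open>O(norm (y - x))\<close>, so the excess is
  \<open>O(norm (y - x)\<^sup>2)\<close> and the two functions have the same derivative at \<open>x\<close>
  (\<open>envelope_quadratic_energy\<close>). The lower bound on the eigenvalues of the Gram matrix enters
  here: it makes the basis functions linearly independent, so that coercivity of the form makes
  the stiffness matrix positive definite.

  One step of mirror descent for the reduced energy \<open>f\<close>, from \<open>x\<close> to \<open>y\<close>, is then compared
  with a minimiser \<open>s\<close> which is a Bregman projection of \<open>x\<close> and towards which \<open>f\<close> is convex. Three inequalities
  are added (\<open>mirror_step_progress\<close>): the descent lemma between \<open>x\<close> and \<open>y\<close>, the tangent
  inequality of convexity between \<open>x\<close> and \<open>s\<close>, and the optimality of \<open>y\<close> in the proximal problem.
  Strong convexity of \<open>\<psi>\<close> and \<open>\<gamma> \<le> \<mu> / L\<close> bound \<open>\<gamma>\<close> times the quadratic term of the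
  descent lemma by the divergence of \<open>y\<close> from \<open>x\<close>, which leaves
  \<open>\<gamma> * (f y - f s) \<le> bregman \<psi> s x - bregman \<psi> s y\<close>. The right-hand side is at most the
  decrease of the Bregman distance to the set of minimisers, since \<open>s\<close> attains this distance at
  \<open>x\<close> and is one competitor at \<open>y\<close>. The distance therefore decreases, the iterates stay in the
  neighbourhood where directional convexity holds, and the sum over the steps telescopes. The
  values of \<open>f\<close> decrease too, so the last one is bounded by their weighted mean
  (\<open>mirror_descent_directional_convexity\<close>).
\<close>

section \<open>Gradients and first-order inequalities\<close>

lemma GDERIV_grad:
  fixes f :: "'a::euclidean_space \<Rightarrow> real"
  assumes "f differentiable (at x)"
  shows "GDERIV f x :> grad f x"
proof -
  obtain f' where f': "(f has_derivative f') (at x)"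
    using assms unfolding differentiable_def by blast
  then have lin: "linear f'"
    using has_derivative_linear by blast
  have "f' h = h \<bullet> (\<Sum>b\<in>Basis. f' b *\<^sub>R b)" for h
  proof -
    have "f' h = f' (\<Sum>b\<in>Basis. (h \<bullet> b) *\<^sub>R b)"
      by (simp add: euclidean_representation)
    then show ?thesis
      by (simp add: linear_sum[OF lin] linear_cmul[OF lin] inner_sum_right mult.commute)
  qed
  then have "f' = (\<lambda>h. h \<bullet> (\<Sum>b\<in>Basis. f' b *\<^sub>R b))"
    by (rule ext)
  with f' have D: "GDERIV f x :> (\<Sum>b\<in>Basis. f' b *\<^sub>R b)"
    unfolding gderiv_def by (rule back_subst)
  show ?thesis
    unfolding grad_eqI[OF D] by (rule D)
qed

lemma differentiable_near_imp_GDERIV: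
  fixes f :: "'a::euclidean_space \<Rightarrow> real"
  assumes "differentiable_near f X" and "x \<in> X"
  shows "f differentiable (at x)" and "GDERIV f x :> grad f x"
proof -
  obtain N where "open N" "X \<subseteq> N" "f differentiable_on N"
    using assms(1) unfolding differentiable_near_def by blast
  then show "f differentiable (at x)"
    using assms(2) differentiable_on_eq_differentiable_at by blast
  then show "GDERIV f x :> grad f x"
    by (rule GDERIV_grad)
qed

lemma GDERIV_along_line:
  assumes "GDERIV f (x + t *\<^sub>R h) :> D"
  shows "((\<lambda>t. f (x + t *\<^sub>R h)) has_real_derivative D \<bullet> h) (at t)"
proof -
  have "((\<lambda>t. x + t *\<^sub>R h) has_derivative (\<lambda>s. s *\<^sub>R h)) (at t)"
    by (auto intro!: derivative_eq_intros)
  from has_derivative_compose[OF this assms[unfolded gderiv_def]]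
  show ?thesis
    unfolding has_field_derivative_def by (simp add: inner_commute mult_commute_abs)
qed

text \<open>
  The common source of the two inequalities below: a bound on all secant slopes from \<open>x\<close> in the
  direction \<open>h\<close> passes to the limit. With \<open>c\<close> the increment of a convex function it yields the
  tangent inequality, with \<open>c = 0\<close> the first-order condition at a minimiser.
\<close>

lemma gradient_le_secant_bound:
  assumes D: "GDERIV f x :> D"
    and le: "\<And>t. 0 < t \<Longrightarrow> t \<le> 1 \<Longrightarrow> f (x + t *\<^sub>R h) \<le> f x + t * c"
  shows "D \<bullet> h \<le> c"
proof -
  have "((\<lambda>t. f (x + t *\<^sub>R h)) has_real_derivative D \<bullet> h) (at 0)"
    using D by (intro GDERIV_along_line) simp
  then have "((\<lambda>t. (f (x + t *\<^sub>R h) - f x) / t) \<longlongrightarrow> D \<bullet> h) (at_right 0)"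
    unfolding has_field_derivative_iff by (auto intro: filterlim_mono at_le)
  moreover have "\<forall>\<^sub>F t in at_right 0. (f (x + t *\<^sub>R h) - f x) / t \<le> c"
    unfolding eventually_at_right_field
    using le by (intro exI[of _ 1]) (auto simp: field_simps dest: less_imp_le)
  ultimately show ?thesis
    by (rule tendsto_upperbound) simp
qed

lemma convex_on_segment_tangent_le:
  assumes cv: "convex_on (closed_segment x s) f" and D: "GDERIV f x :> D"
  shows "f x + D \<bullet> (s - x) \<le> f s"
proof -
  have "D \<bullet> (s - x) \<le> f s - f x"
  proof (rule gradient_le_secant_bound[OF D])
    fix t :: real
    assume "0 < t" "t \<le> 1"
    then have "f ((1 - t) *\<^sub>R x + t *\<^sub>R s) \<le> (1 - t) * f x + t * f s"
      by (intro convex_onD[OF cv]) auto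
    then show "f (x + t *\<^sub>R (s - x)) \<le> f x + t * (f s - f x)"
      by (simp add: algebra_simps)
  qed
  then show ?thesis by simp
qed

lemma variational_inequality:
  assumes D: "GDERIV F y :> D" and "convex X" "y \<in> X" "s \<in> X"
    and min: "\<And>z. z \<in> X \<Longrightarrow> F y \<le> F z"
  shows "0 \<le> D \<bullet> (s - y)"
proof -
  have "- D \<bullet> (s - y) \<le> 0"
  proof (rule gradient_le_secant_bound[OF GDERIV_minus[OF D]])
    fix t :: real
    assume "0 < t" "t \<le> 1"
    then have "(1 - t) *\<^sub>R y + t *\<^sub>R s \<in> X"
      using assms(2-4) by (intro convexD_alt) auto
    then show "- F (y + t *\<^sub>R (s - y)) \<le> - F y + t * 0"
      using min by (simp add: algebra_simps)
  qed
  then show ?thesis by simp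
qed

section \<open>Positive definite forms and dual norms\<close>

text \<open>
  The constant is the minimum of the form on the unit sphere, which is compact in finite
  dimension. It is used for the inner product that defines the norm on the nonlinear parameters
  as well as for stiffness matrices.
\<close>

lemma positive_definite_imp_coercive:
  fixes h :: "'a::euclidean_space \<Rightarrow> 'a \<Rightarrow> real"
  assumes h: "bounded_bilinear h" and pos: "\<And>v. v \<noteq> 0 \<Longrightarrow> 0 < h v v"
  shows "\<exists>c>0. \<forall>v. c * (norm v)\<^sup>2 \<le> h v v"
proof -
  interpret h: bounded_bilinear h by fact
  have "continuous_on (sphere 0 1) (\<lambda>v. h v v)"
    by (intro h.continuous_on continuous_on_id)
  moreover have "sphere (0::'a) 1 \<noteq> {}"
    by simp
  ultimately obtain u where u: "u \<in> sphere 0 1" "\<forall>v\<in>sphere 0 1. h u u \<le> h v v"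
    using continuous_attains_inf[OF compact_sphere, of 0 1 "\<lambda>v. h v v"] by blast
  have "h u u * (norm v)\<^sup>2 \<le> h v v" for v
  proof (cases "v = 0")
    case False
    then have "h u u \<le> h (v /\<^sub>R norm v) (v /\<^sub>R norm v)"
      by (intro u(2)[rule_format]) simp
    also have "\<dots> = h v v / (norm v)\<^sup>2"
      by (simp add: h.scaleR_left h.scaleR_right power2_eq_square divide_simps)
    finally show ?thesis
      using False by (simp add: field_simps)
  qed (simp add: h.zero_left)
  moreover have "0 < h u u"
    using u(1) by (intro pos) auto
  ultimately show ?thesis
    by blast
qed

lemma is_inner_product_bounded_bilinear:
  fixes B :: "'a::euclidean_space \<Rightarrow> 'a \<Rightarrow> real"
  assumes "is_inner_product B"
  shows "bounded_bilinear B"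
proof -
  have "linear (B x)" "B x = (\<lambda>y. B y x)" for x
    using assms unfolding is_inner_product_def by auto
  then have "bilinear B"
    unfolding bilinear_def by metis
  then show ?thesis
    by (simp add: bilinear_conv_bounded_bilinear)
qed

lemma ip_norm_scaleR:
  fixes B :: "'a::euclidean_space \<Rightarrow> 'a \<Rightarrow> real"
  assumes "is_inner_product B"
  shows "ip_norm B (t *\<^sub>R v) = \<bar>t\<bar> * ip_norm B v"
proof -
  interpret B: bounded_bilinear B
    using assms by (rule is_inner_product_bounded_bilinear)
  show ?thesis
    by (simp add: ip_norm_def B.scaleR_left B.scaleR_right real_sqrt_mult flip: mult.assoc)
qed

text \<open>
  Besides homogeneity this needs the supremum in the dual norm to be over a bounded set, because
  \<open>Sup\<close> of an unbounded set of reals is an unspecified value. The unit ball of \<open>ip_norm B\<close> is Euclidean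
  bounded by coercivity of \<open>B\<close>.
\<close>

lemma dual_norm_pairing_le:
  fixes B :: "'a::euclidean_space \<Rightarrow> 'a \<Rightarrow> real"
  assumes B: "is_inner_product B"
  shows "g \<bullet> v \<le> dual_norm B g * ip_norm B v"
proof -
  have "0 < B v v" if "v \<noteq> 0" for v
    using B that unfolding is_inner_product_def by blast
  then obtain c where c: "0 < c" "\<And>v. c * (norm v)\<^sup>2 \<le> B v v"
    using positive_definite_imp_coercive[OF is_inner_product_bounded_bilinear[OF B]] by blast
  have "g \<bullet> u \<le> norm g * sqrt (1 / c)" if "ip_norm B u \<le> 1" for u
  proof -
    have "(norm u)\<^sup>2 \<le> 1 / c"
      using that c(2)[of u] \<open>0 < c\<close> by (simp add: ip_norm_def field_simps)
    then have "norm u \<le> sqrt (1 / c)"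
      by (rule real_le_rsqrt)
    then show ?thesis
      using norm_cauchy_schwarz[of g u] mult_left_mono[of "norm u" "sqrt (1 / c)" "norm g"] by simp
  qed
  then have bdd: "bdd_above ((\<bullet>) g ` {u. ip_norm B u \<le> 1})"
    by (intro bdd_aboveI2) auto
  show ?thesis
  proof (cases "v = 0")
    case False
    then have pos: "0 < ip_norm B v"
      using B unfolding is_inner_product_def ip_norm_def by simp
    have "ip_norm B (v /\<^sub>R ip_norm B v) \<le> 1"
      using pos by (simp add: ip_norm_scaleR[OF B])
    then have "g \<bullet> (v /\<^sub>R ip_norm B v) \<le> dual_norm B g"
      unfolding dual_norm_def by (intro cSUP_upper bdd) simp
    then show ?thesis
      using pos by (simp add: field_simps)
  qed (use ip_norm_scaleR[OF B, of 0 0] in simp)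
qed

text \<open>
  The descent lemma. Along the segment, \<open>f\<close> minus the claimed quadratic upper bound has a
  nonpositive derivative, since the slope of \<open>f\<close> grows at rate at most \<open>L\<close> times the squared length
  of the segment.
\<close>

lemma lipschitz_gradient_upper_bound:
  fixes f :: "'a::euclidean_space \<Rightarrow> real"
  assumes B: "is_inner_product B" and X: "convex X" "x \<in> X" "y \<in> X"
    and grad: "\<And>z. z \<in> X \<Longrightarrow> GDERIV f z :> grad f z"
    and lip: "\<And>u v. u \<in> X \<Longrightarrow> v \<in> X \<Longrightarrow>
      dual_norm B (grad f u - grad f v) \<le> L * ip_norm B (u - v)"
  shows "f y \<le> f x + grad f x \<bullet> (y - x) + L / 2 * (ip_norm B (y - x))\<^sup>2"
proof -
  define h where "h = y - x"
  define r where
    "r t = f (x + t *\<^sub>R h) - t * (grad f x \<bullet> h) - t\<^sup>2 * (L / 2 * (ip_norm B h)\<^sup>2)" for t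
  have "r 1 \<le> r 0"
  proof (rule DERIV_nonpos_imp_nonincreasing[of 0 1 r])
    fix t :: real
    assume t: "0 \<le> t" "t \<le> 1"
    have seg: "x + t *\<^sub>R h \<in> X"
      using convexD_alt[OF X(1,2,3) t] by (simp add: h_def algebra_simps)
    have "(r has_real_derivative
        grad f (x + t *\<^sub>R h) \<bullet> h - grad f x \<bullet> h - t * (L * (ip_norm B h)\<^sup>2)) (at t)"
      unfolding r_def
      by (rule derivative_eq_intros GDERIV_along_line[OF grad[OF seg]] refl | simp)+
    moreover have "grad f (x + t *\<^sub>R h) \<bullet> h - grad f x \<bullet> h \<le> t * (L * (ip_norm B h)\<^sup>2)"
    proof -
      have "(grad f (x + t *\<^sub>R h) - grad f x) \<bullet> h
          \<le> dual_norm B (grad f (x + t *\<^sub>R h) - grad f x) * ip_norm B h"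
        by (rule dual_norm_pairing_le[OF B])
      also have "\<dots> \<le> (L * ip_norm B (t *\<^sub>R h)) * ip_norm B h"
      proof (rule mult_right_mono)
        show "dual_norm B (grad f (x + t *\<^sub>R h) - grad f x) \<le> L * ip_norm B (t *\<^sub>R h)"
          using lip[OF seg X(2)] by simp
        show "0 \<le> ip_norm B h"
          using B unfolding is_inner_product_def ip_norm_def
          by (cases "h = 0") (auto simp: less_imp_le linear_0)
      qed
      finally show ?thesis
        using t by (simp add: ip_norm_scaleR[OF B] inner_diff_left power2_eq_square mult_ac)
    qed
    ultimately show "\<exists>d. (r has_real_derivative d) (at t) \<and> d \<le> 0"
      by force
  qed simp
  then show ?thesis
    by (simp add: r_def h_def)
qed

section \<open>Mirror descent\<close>

lemma bregman_lower_bound: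
  assumes "strongly_convex_wrt B \<mu> X \<psi>" "x \<in> X" "y \<in> X"
  shows "\<mu> / 2 * (ip_norm B (y - x))\<^sup>2 \<le> bregman \<psi> y x"
proof -
  have "\<psi> x + grad \<psi> x \<bullet> (y - x) + \<mu> / 2 * (ip_norm B (y - x))\<^sup>2 \<le> \<psi> y"
    using assms unfolding strongly_convex_wrt_def by blast
  then show ?thesis
    unfolding bregman_def by linarith
qed

text \<open>
  The first-order condition for the proximal problem at \<open>y\<close>, tested with \<open>s\<close>, bounds the left-hand
  side by \<open>(grad \<psi> y - grad \<psi> x) \<bullet> (s - y)\<close>. By the three-point identity of Bregman divergences
  this is exactly the right-hand side.
\<close>

lemma bregman_proximal_inequality:
  fixes \<psi> :: "'a::real_inner \<Rightarrow> real"
  assumes \<psi>: "GDERIV \<psi> y :> grad \<psi> y" and X: "convex X" "s \<in> X"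
    and min: "is_arg_min (\<lambda>\<eta>. \<gamma> * (g \<bullet> \<eta>) + bregman \<psi> \<eta> x) (\<lambda>\<eta>. \<eta> \<in> X) y"
  shows "\<gamma> * (g \<bullet> (y - s)) \<le> bregman \<psi> s x - bregman \<psi> s y - bregman \<psi> y x"
proof -
  have linear: "GDERIV (\<lambda>\<eta>. \<eta> \<bullet> c) y :> c" for c :: 'a
    unfolding gderiv_def by (auto intro!: derivative_eq_intros)
  \<comment> \<open>up to a constant, the objective is a linear function plus the mirror map\<close>
  have "GDERIV (\<lambda>\<eta>. \<eta> \<bullet> (\<gamma> *\<^sub>R g - grad \<psi> x) + \<psi> \<eta> + (grad \<psi> x \<bullet> x - \<psi> x)) y
      :> \<gamma> *\<^sub>R g - grad \<psi> x + grad \<psi> y + 0"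
    by (intro GDERIV_add linear \<psi> GDERIV_const)
  also have "(\<lambda>\<eta>. \<eta> \<bullet> (\<gamma> *\<^sub>R g - grad \<psi> x) + \<psi> \<eta> + (grad \<psi> x \<bullet> x - \<psi> x))
      = (\<lambda>\<eta>. \<gamma> * (g \<bullet> \<eta>) + bregman \<psi> \<eta> x)"
    by (auto simp: bregman_def inner_diff_right inner_commute)
  finally have "0 \<le> (\<gamma> *\<^sub>R g - grad \<psi> x + grad \<psi> y + 0) \<bullet> (s - y)"
    by (rule variational_inequality)
      (use X min in \<open>auto simp: is_arg_min_linorder\<close>)
  then show ?thesis
    by (simp add: bregman_def inner_diff_left inner_diff_right inner_add_left algebra_simps)
qed

text \<open>
  The step size condition is what lets \<open>bregman_lower_bound\<close> absorb the quadratic error of the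
  descent lemma. With \<open>s\<close> a minimiser this is the estimate that telescopes; with \<open>s = x\<close> it says
  that \<open>f\<close> decreases along the step.
\<close>

lemma mirror_step_progress:
  fixes f \<psi> :: "'a::euclidean_space \<Rightarrow> real"
  assumes B: "is_inner_product B" and X: "convex X" "x \<in> X" "s \<in> X"
    and f: "\<And>z. z \<in> X \<Longrightarrow> GDERIV f z :> grad f z"
    and lip: "\<And>u v. u \<in> X \<Longrightarrow> v \<in> X \<Longrightarrow>
      dual_norm B (grad f u - grad f v) \<le> L * ip_norm B (u - v)"
    and \<psi>: "GDERIV \<psi> y :> grad \<psi> y" "strongly_convex_wrt B \<mu> X \<psi>"
    and step: "0 < L" "0 < \<gamma>" "\<gamma> \<le> \<mu> / L"
    and min: "is_arg_min (\<lambda>\<eta>. \<gamma> * (grad f x \<bullet> \<eta>) + bregman \<psi> \<eta> x) (\<lambda>\<eta>. \<eta> \<in> X) y"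
    and cv: "convex_on (closed_segment x s) f"
  shows "\<gamma> * (f y - f s) \<le> bregman \<psi> s x - bregman \<psi> s y"
proof -
  let ?n = "(ip_norm B (y - x))\<^sup>2"
  have y: "y \<in> X"
    using min by (simp add: is_arg_min_def)
  have "f y - f s \<le> grad f x \<bullet> (y - s) + L / 2 * ?n"
    using lipschitz_gradient_upper_bound[OF B X(1,2) y f lip]
      convex_on_segment_tangent_le[OF cv f[OF X(2)]]
    by (simp add: inner_diff_right)
  then have "\<gamma> * (f y - f s) \<le> \<gamma> * (grad f x \<bullet> (y - s) + L / 2 * ?n)"
    using step(2) by (intro mult_left_mono) auto
  also have "\<dots> = \<gamma> * (grad f x \<bullet> (y - s)) + (\<gamma> * L) / 2 * ?n"
    by (simp add: algebra_simps)
  also have "\<dots> \<le> \<gamma> * (grad f x \<bullet> (y - s)) + \<mu> / 2 * ?n"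
    using step by (intro add_left_mono mult_right_mono) (auto simp: field_simps)
  also have "\<dots> \<le> bregman \<psi> s x - bregman \<psi> s y"
    using bregman_proximal_inequality[OF \<psi>(1) X(1,3) min] bregman_lower_bound[OF \<psi>(2) X(2) y]
    by linarith
  finally show ?thesis .
qed

text \<open>
  Convexity is only available between an iterate in the neighbourhood and its own projection,
  which changes with the iterate. The potential is therefore the distance to the whole set \<open>S\<close>,
  and its decrease is also what keeps the iterates in the neighbourhood.
\<close>

theorem mirror_descent_directional_convexity:
  fixes f \<psi> :: "'a::euclidean_space \<Rightarrow> real" and \<gamma> :: "nat \<Rightarrow> real" and S :: "'a set"
  defines "\<delta> \<equiv> bregman_dist \<psi> S"
  assumes B: "is_inner_product B" and X: "convex X"
    and S: "S \<subseteq> X" "\<And>s. s \<in> S \<Longrightarrow> f s = m" "\<And>z. z \<in> X \<Longrightarrow> m \<le> f z"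
    and f: "\<And>z. z \<in> X \<Longrightarrow> GDERIV f z :> grad f z"
    and lip: "\<And>u v. u \<in> X \<Longrightarrow> v \<in> X \<Longrightarrow>
      dual_norm B (grad f u - grad f v) \<le> L * ip_norm B (u - v)"
    and \<psi>: "\<And>z. z \<in> X \<Longrightarrow> GDERIV \<psi> z :> grad \<psi> z" "0 < \<mu>" "strongly_convex_wrt B \<mu> X \<psi>"
    and dir: "directionally_convex_on \<psi> S f (bregman_nbhd \<psi> S X \<rho>)"
    and init: "\<xi> 0 \<in> bregman_nbhd \<psi> S X \<rho>"
    and step: "0 < L" "\<And>k. 0 < \<gamma> k" "\<And>k. \<gamma> k \<le> \<mu> / L"
    and min: "\<And>k. is_arg_min (\<lambda>\<eta>. \<gamma> k * (grad f (\<xi> k) \<bullet> \<eta>) + bregman \<psi> \<eta> (\<xi> k))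
      (\<lambda>\<eta>. \<eta> \<in> X) (\<xi> (Suc k))"
  shows "\<And>k. \<delta> (\<xi> (Suc k)) \<le> \<delta> (\<xi> k)"
    and "\<And>k. \<xi> k \<in> bregman_nbhd \<psi> S X (\<delta> (\<xi> 0))"
    and "\<And>n. 1 \<le> n \<Longrightarrow> f (\<xi> n) \<le> m + \<delta> (\<xi> 0) / (\<Sum>k<n. \<gamma> k)"
proof -
  have breg_nonneg: "0 \<le> bregman \<psi> y x" if "x \<in> X" "y \<in> X" for x y
  proof -
    have "0 \<le> \<mu> / 2 * (ip_norm B (y - x))\<^sup>2"
      using \<psi>(2) by simp
    then show ?thesis
      using bregman_lower_bound[OF \<psi>(3) that] by linarith
  qed
  have \<delta>_le: "\<delta> x \<le> bregman \<psi> s x" if "x \<in> X" "s \<in> S" for x s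
    unfolding \<delta>_def bregman_dist_def
    using that S(1) breg_nonneg by (intro cINF_lower bdd_belowI2[where m = 0]) auto
  have in_X: "\<xi> k \<in> X" for k
    using init min[of "k - 1"] by (cases k) (auto simp: bregman_nbhd_def is_arg_min_def)
  have progress: "\<gamma> k * (f (\<xi> (Suc k)) - f s) \<le> bregman \<psi> s (\<xi> k) - bregman \<psi> s (\<xi> (Suc k))"
    if "s \<in> X" "convex_on (closed_segment (\<xi> k) s) f" for k s
    by (rule mirror_step_progress[OF B X in_X that(1) f lip \<psi>(1)[OF in_X] \<psi>(3) step(1,2,3) min
          that(2)])
  have nbhd: "\<exists>s\<in>S. bregman \<psi> s (\<xi> k) = \<delta> (\<xi> k) \<and> convex_on (closed_segment (\<xi> k) s) f"
    if "\<xi> k \<in> bregman_nbhd \<psi> S X \<rho>" for k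
    using dir that unfolding directionally_convex_on_def bregman_proj_def \<delta>_def by blast
  have decrease: "f (\<xi> (Suc k)) \<le> f (\<xi> k)" for k
  proof -
    \<comment> \<open>the comparison point is the current iterate: any function is convex on a single point\<close>
    have "\<gamma> k * (f (\<xi> (Suc k)) - f (\<xi> k))
        \<le> bregman \<psi> (\<xi> k) (\<xi> k) - bregman \<psi> (\<xi> k) (\<xi> (Suc k))"
      by (rule progress) (auto simp: in_X convex_on_def simp flip: scaleR_left_distrib distrib_right)
    also have "\<dots> \<le> 0"
      using breg_nonneg[OF in_X in_X] by (simp add: bregman_def[of _ "\<xi> k" "\<xi> k"])
    finally show ?thesis
      using step(2)[of k] by (simp add: mult_le_0_iff)
  qed
  have gap: "\<gamma> k * (f (\<xi> (Suc k)) - m) \<le> \<delta> (\<xi> k) - \<delta> (\<xi> (Suc k))"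
    if in_nbhd: "\<xi> k \<in> bregman_nbhd \<psi> S X \<rho>" for k
  proof -
    obtain s where s: "s \<in> S" "bregman \<psi> s (\<xi> k) = \<delta> (\<xi> k)"
      "convex_on (closed_segment (\<xi> k) s) f"
      using nbhd[OF in_nbhd] by blast
    then show ?thesis
      using progress[of s k] \<delta>_le[OF in_X s(1), of "Suc k"] S by auto
  qed
  have closer: "\<delta> (\<xi> (Suc k)) \<le> \<delta> (\<xi> k)" if "\<xi> k \<in> bregman_nbhd \<psi> S X \<rho>" for k
  proof -
    have "0 \<le> \<gamma> k * (f (\<xi> (Suc k)) - m)"
      using step(2)[of k] S(3)[OF in_X, of "Suc k"] by (intro mult_nonneg_nonneg) auto
    then show ?thesis
      using gap[OF that] by linarith
  qed
  have in_nbhd: "\<xi> k \<in> bregman_nbhd \<psi> S X \<rho>" for k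
  proof (induction k)
    case (Suc k)
    then show ?case
      using closer[OF Suc] in_X[of "Suc k"] by (simp add: bregman_nbhd_def \<delta>_def)
  qed (rule init)
  show mono: "\<delta> (\<xi> (Suc k)) \<le> \<delta> (\<xi> k)" for k
    using closer in_nbhd by blast
  have "\<delta> (\<xi> k) \<le> \<delta> (\<xi> 0)" for k
    by (rule lift_Suc_antimono_le[of "\<lambda>k. \<delta> (\<xi> k)", OF mono]) simp
  then show "\<xi> k \<in> bregman_nbhd \<psi> S X (\<delta> (\<xi> 0))" for k
    using in_X unfolding bregman_nbhd_def \<delta>_def by blast
  show "f (\<xi> n) \<le> m + \<delta> (\<xi> 0) / (\<Sum>k<n. \<gamma> k)" if "1 \<le> n" for n
  proof -
    \<comment> \<open>the last value is the smallest, so it is below the mean with weights \<open>\<gamma> k\<close>\<close>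
    have "(\<Sum>k<n. \<gamma> k) * (f (\<xi> n) - m) \<le> (\<Sum>k<n. \<gamma> k * (f (\<xi> (Suc k)) - m))"
      unfolding sum_distrib_right
    proof (rule sum_mono)
      fix k assume "k \<in> {..<n}"
      then have "f (\<xi> n) \<le> f (\<xi> (Suc k))"
        by (intro lift_Suc_antimono_le[of "\<lambda>k. f (\<xi> k)", OF decrease]) simp
      then show "\<gamma> k * (f (\<xi> n) - m) \<le> \<gamma> k * (f (\<xi> (Suc k)) - m)"
        using step(2)[of k] by (intro mult_left_mono) auto
    qed
    also have "\<dots> \<le> (\<Sum>k<n. \<delta> (\<xi> k) - \<delta> (\<xi> (Suc k)))"
      using gap in_nbhd by (intro sum_mono) auto
    also have "\<dots> = \<delta> (\<xi> 0) - \<delta> (\<xi> n)"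
      by (rule sum_lessThan_telescope')
    also have "\<dots> \<le> \<delta> (\<xi> 0)"
      using nbhd[OF in_nbhd[of n]] breg_nonneg[OF in_X, of _ n] S(1) by force
    finally have "(\<Sum>k<n. \<gamma> k) * (f (\<xi> n) - m) \<le> \<delta> (\<xi> 0)" .
    moreover have "0 < (\<Sum>k<n. \<gamma> k)"
      using that step(2) by (intro sum_pos) (auto simp: lessThan_empty_iff)
    ultimately show ?thesis
      by (simp add: field_simps)
  qed
qed

section \<open>Envelopes of quadratic minimisation problems\<close>

definition quadratic_energy :: "real ^ 'l ^ 'l \<Rightarrow> real ^ 'l \<Rightarrow> real ^ 'l \<Rightarrow> real" where
  "quadratic_energy M b v = v \<bullet> (M *v v) / 2 - v \<bullet> b"

lemma bounded_bilinear_matrix_vector_mult: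
  "bounded_bilinear ((*v) :: real ^ 'm ^ 'l \<Rightarrow> real ^ 'm \<Rightarrow> real ^ 'l)"
  unfolding bilinear_conv_bounded_bilinear[symmetric] bilinear_def
  by (auto intro!: linearI simp: algebra_simps scaleR_matrix_vector_assoc)

lemma bounded_bilinear_quadratic_form:
  fixes M :: "real ^ 'l ^ 'l"
  shows "bounded_bilinear (\<lambda>u v. u \<bullet> (M *v v))"
  by (rule bounded_bilinear.comp[OF bounded_bilinear_inner bounded_linear_ident
        matrix_vector_mul_bounded_linear])

lemma positive_definite_imp_invertible:
  fixes M :: "real ^ 'l ^ 'l"
  assumes "\<And>v. v \<noteq> 0 \<Longrightarrow> 0 < v \<bullet> (M *v v)"
  shows "M *v (matrix_inv M *v b) = b"
proof -
  have "inj ((*v) M)"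
    unfolding vec.inj_iff_eq_0 using assms by fastforce
  then have "invertible M"
    using matrix_left_invertible_injective invertible_left_inverse by blast
  then have "M ** matrix_inv M = mat 1"
    unfolding invertible_def matrix_inv_def by (rule someI2_ex) simp
  then show ?thesis
    by (simp add: matrix_vector_mul_assoc)
qed

text \<open>
  Completing the square: the linear term vanishes because \<open>w\<close> solves the system, so the excess over
  the value at \<open>w\<close> is purely quadratic. For a positive semidefinite \<open>M\<close> this shows that \<open>w\<close> is a
  minimiser.
\<close>

lemma quadratic_energy_excess:
  assumes sym: "transpose M = M" and w: "M *v w = b"
  shows "quadratic_energy M b v = quadratic_energy M b w + (v - w) \<bullet> (M *v (v - w)) / 2"
proof -
  have "w \<bullet> (M *v v) = v \<bullet> (M *v w)"
    using sym by (metis dot_lmul_matrix inner_commute transpose_matrix_vector)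
  then show ?thesis
    unfolding quadratic_energy_def w[symmetric]
    by (simp add: matrix_vector_mult_diff_distrib inner_diff_left inner_diff_right field_simps)
qed

text \<open>
  One constant serves all matrices near \<open>M x\<close>. It is half the constant of \<open>M x\<close>, the other half
  pays for the perturbation \<open>M y - M x\<close>.
\<close>

lemma eventually_quadratic_form_coercive:
  fixes M :: "'x::real_normed_vector \<Rightarrow> real ^ 'l ^ 'l"
  assumes M: "isCont M x" and pos: "\<And>v. v \<noteq> 0 \<Longrightarrow> 0 < v \<bullet> (M x *v v)"
  shows "\<exists>c>0. \<forall>\<^sub>F y in nhds x. \<forall>v. c * (norm v)\<^sup>2 \<le> v \<bullet> (M y *v v)"
proof -
  obtain c where c: "0 < c" "\<And>v. c * (norm v)\<^sup>2 \<le> v \<bullet> (M x *v v)"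
    using positive_definite_imp_coercive[OF bounded_bilinear_quadratic_form pos] by blast
  obtain K where K: "0 < K"
    "\<And>(A :: real ^ 'l ^ 'l) (v :: real ^ 'l). norm (A *v v) \<le> norm A * norm v * K"
    using bounded_bilinear.pos_bounded[OF bounded_bilinear_matrix_vector_mult] by blast
  \<comment> \<open>perturbations of this size change the form by at most \<open>c / 2 * (norm v)\<^sup>2\<close>\<close>
  have "\<forall>\<^sub>F y in nhds x. dist (M y) (M x) < c / (2 * K)"
    using M c(1) K(1) unfolding isCont_def tendsto_at_iff_tendsto_nhds
    by (intro tendstoD) auto
  then have "\<forall>\<^sub>F y in nhds x. \<forall>v. c / 2 * (norm v)\<^sup>2 \<le> v \<bullet> (M y *v v)"
  proof (rule eventually_mono, intro allI)
    fix y and v :: "real ^ 'l"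
    assume near: "dist (M y) (M x) < c / (2 * K)"
    have "- (v \<bullet> ((M y - M x) *v v)) \<le> norm v * norm ((M y - M x) *v v)"
      using Cauchy_Schwarz_ineq2[of v "(M y - M x) *v v"] by linarith
    also have "\<dots> \<le> norm v * (norm (M y - M x) * norm v * K)"
      by (intro mult_left_mono K(2)) simp
    also have "\<dots> = (norm (M y - M x) * K) * (norm v)\<^sup>2"
      by (simp add: power2_eq_square mult_ac)
    also have "\<dots> \<le> c / 2 * (norm v)\<^sup>2"
      using near K(1) by (intro mult_right_mono) (auto simp: dist_norm field_simps)
    finally show "c / 2 * (norm v)\<^sup>2 \<le> v \<bullet> (M y *v v)"
      using c(2)[of v] by (simp add: matrix_vector_mult_diff_rdistrib inner_diff_right)
  qed
  then show ?thesis
    using c(1) by (intro exI[of _ "c / 2"]) auto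
qed

lemma differentiable_imp_locally_lipschitz_at:
  assumes "f differentiable (at x)"
  obtains C where "0 < C" "\<forall>\<^sub>F y in nhds x. norm (f y - f x) \<le> C * norm (y - x)"
proof -
  obtain f' where f': "(f has_derivative f') (at x)"
    using assms unfolding differentiable_def by blast
  then obtain K where K: "0 < K" "\<And>h. norm (f' h) \<le> norm h * K"
    using bounded_linear.pos_bounded[OF has_derivative_bounded_linear] by blast
  obtain d where d: "0 < d"
    "\<And>y. norm (y - x) < d \<Longrightarrow> norm (f y - f x - f' (y - x)) \<le> 1 * norm (y - x)"
    using f' unfolding has_derivative_at_alt by (meson zero_less_one)
  have "norm (f y - f x) \<le> (K + 1) * norm (y - x)" if "dist y x < d" for y
    using d(2)[of y] that K(2)[of "y - x"] norm_triangle_sub[of "f y - f x" "f' (y - x)"]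
    by (simp add: dist_norm algebra_simps)
  then show ?thesis
    using that[of "K + 1"] K(1) d(1) unfolding eventually_nhds_metric by auto
qed

lemma has_derivative_squeeze_quadratic:
  fixes f g :: "'x::real_normed_vector \<Rightarrow> real"
  assumes g: "(g has_derivative g') (at x)"
    and C: "0 < C" "\<forall>\<^sub>F y in nhds x. \<bar>g y - f y\<bar> \<le> C * (norm (y - x))\<^sup>2"
  shows "(f has_derivative g') (at x)"
proof -
  have fx: "g x = f x"
    using eventually_nhds_x_imp_x[OF C(2)] by simp
  obtain r where r: "0 < r" "\<And>y. norm (y - x) < r \<Longrightarrow> \<bar>g y - f y\<bar> \<le> C * (norm (y - x))\<^sup>2"
    using C(2) unfolding eventually_nhds_metric dist_norm by blast
  have "((\<lambda>y. g y - f y) has_derivative (\<lambda>h. 0)) (at x)"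
    unfolding has_derivative_at_alt
  proof (intro conjI allI impI)
    fix e :: real
    assume e: "0 < e"
    have "norm (g y - f y - (g x - f x) - 0) \<le> e * norm (y - x)"
      if y: "norm (y - x) < min r (e / C)" for y
    proof -
      have "\<bar>g y - f y\<bar> \<le> (C * norm (y - x)) * norm (y - x)"
        using r(2)[of y] y by (simp add: power2_eq_square mult.assoc)
      also have "\<dots> \<le> e * norm (y - x)"
        using y C(1) by (intro mult_right_mono) (auto simp: field_simps)
      finally show ?thesis
        by (simp add: fx)
    qed
    then show "\<exists>d>0. \<forall>y. norm (y - x) < d \<longrightarrow> norm (g y - f y - (g x - f x) - 0) \<le> e * norm (y - x)"
      using r(1) e C(1) by (intro exI[of _ "min r (e / C)"]) auto
  qed simp
  from has_derivative_diff[OF g this] show ?thesis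
    by simp
qed

text \<open>
  The excess of the value at the frozen point \<open>w x\<close> over the minimum at \<open>y\<close> is \<open>d \<bullet> r / 2\<close>, where
  \<open>d = w x - w y\<close> and \<open>r = M y *v d\<close> is the residual of \<open>w x\<close> in the system at \<open>y\<close>. Coercivity
  near \<open>x\<close>, with constant \<open>c\<close>, bounds \<open>norm d\<close> by \<open>norm r / c\<close>, and \<open>r\<close> vanishes at \<open>x\<close> and is
  differentiable there. Hence the excess is quadratically small and does not affect the
  derivative. Positive definiteness passes from \<open>x\<close> to the points near it by continuity of \<open>M\<close>.
\<close>

theorem envelope_quadratic_energy:
  fixes M :: "'x::real_inner \<Rightarrow> real ^ 'l ^ 'l" and b :: "'x \<Rightarrow> real ^ 'l"
  defines "w \<equiv> \<lambda>y. matrix_inv (M y) *v b y"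
  assumes diff: "M differentiable (at x)" "b differentiable (at x)"
    and sym: "\<And>y. transpose (M y) = M y"
    and pos: "\<And>v. v \<noteq> 0 \<Longrightarrow> 0 < v \<bullet> (M x *v v)"
    and D: "GDERIV (\<lambda>y. quadratic_energy (M y) (b y) (w x)) x :> D"
  shows "GDERIV (\<lambda>y. quadratic_energy (M y) (b y) (w y)) x :> D"
proof -
  define r where "r y = M y *v w x - b y" for y
  have "r x = 0"
    unfolding r_def w_def by (simp add: positive_definite_imp_invertible[OF pos])
  have "(\<lambda>y. M y *v w x) differentiable (at x)"
    using diff(1) bounded_bilinear.FDERIV[OF bounded_bilinear_matrix_vector_mult _ has_derivative_const]
    unfolding differentiable_def by blast
  then have "r differentiable (at x)"
    unfolding r_def using diff(2) by (rule differentiable_diff)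
  then obtain C where C: "0 < C" "\<forall>\<^sub>F y in nhds x. norm (r y - r x) \<le> C * norm (y - x)"
    by (rule differentiable_imp_locally_lipschitz_at)
  have "isCont M x"
    using diff(1) by (rule differentiable_imp_continuous_within)
  then obtain c where c: "0 < c"
    "\<forall>\<^sub>F y in nhds x. \<forall>v. c * (norm v)\<^sup>2 \<le> v \<bullet> (M y *v v)"
    using eventually_quadratic_form_coercive[of x M, OF _ pos] by blast
  have bound: "\<forall>\<^sub>F y in nhds x. \<bar>quadratic_energy (M y) (b y) (w x) - quadratic_energy (M y) (b y) (w y)\<bar>
      \<le> C\<^sup>2 / c * (norm (y - x))\<^sup>2"
    using C(2) c(2)
  proof eventually_elim
    case (elim y)
    define d where "d = w x - w y"
    have "0 < v \<bullet> (M y *v v)" if "v \<noteq> 0" for v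
      using elim(2)[rule_format, of v] that c(1)
      by (smt (verit) mult_pos_pos zero_less_norm_iff zero_less_power)
    then have w: "M y *v w y = b y"
      unfolding w_def by (rule positive_definite_imp_invertible)
    then have Md: "M y *v d = r y"
      by (simp add: d_def r_def matrix_vector_mult_diff_distrib)
    have excess:
      "quadratic_energy (M y) (b y) (w x) - quadratic_energy (M y) (b y) (w y) = d \<bullet> r y / 2"
      using quadratic_energy_excess[OF sym w, of "w x"] Md by (simp add: d_def)
    have "c * (norm d)\<^sup>2 \<le> d \<bullet> r y"
      using elim(2)[rule_format, of d] by (simp add: Md)
    moreover have dr: "d \<bullet> r y \<le> norm d * norm (r y)"
      by (rule norm_cauchy_schwarz)
    ultimately have "(c * norm d) * norm d \<le> norm (r y) * norm d"
      by (simp add: power2_eq_square mult_ac)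
    then have "c * norm d \<le> norm (r y)"
      by (cases "d = 0") (simp_all add: mult_le_cancel_right)
    then have "norm d * norm (r y) \<le> (norm (r y))\<^sup>2 / c"
      using c(1) mult_right_mono[of "c * norm d" "norm (r y)" "norm (r y)"]
      by (simp add: field_simps power2_eq_square)
    also have "\<dots> \<le> (C * norm (y - x))\<^sup>2 / c"
      using elim(1) \<open>r x = 0\<close> c(1) by (intro divide_right_mono power_mono) auto
    finally have "d \<bullet> r y \<le> C\<^sup>2 / c * (norm (y - x))\<^sup>2"
      using dr by (simp add: power_mult_distrib)
    moreover have "0 \<le> d \<bullet> r y"
      using \<open>c * (norm d)\<^sup>2 \<le> d \<bullet> r y\<close> c(1) by (smt (verit) mult_nonneg_nonneg zero_le_power2)
    ultimately show ?case
      unfolding excess by linarith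
  qed
  have "0 < C\<^sup>2 / c"
    using C(1) c(1) by simp
  then show ?thesis
    unfolding gderiv_def
    by (rule has_derivative_squeeze_quadratic[OF D[unfolded gderiv_def] _ bound])
qed

section \<open>The reduced energy\<close>

lemma param_energy_eq_quadratic_energy:
  fixes a :: "'u::real_normed_vector \<Rightarrow> 'u \<Rightarrow> real"
  assumes "bounded_bilinear a" "bounded_linear l"
  shows "param_energy a l \<phi> v x = quadratic_energy (stiffness a \<phi> x) (load l \<phi> x) v"
  using assms by (simp add: param_energy_quadratic quadratic_energy_def)

lemma stiffness_quadratic_form:
  fixes a :: "'u::real_normed_vector \<Rightarrow> 'u \<Rightarrow> real"
  assumes "bounded_bilinear a"
  shows "v \<bullet> (stiffness a \<phi> x *v v) = a (realization \<phi> v x) (realization \<phi> v x)"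
proof -
  have "param_energy a (\<lambda>_. 0) \<phi> v x = v \<bullet> (stiffness a \<phi> x *v v) / 2 - v \<bullet> load (\<lambda>_. 0) \<phi> x"
    using assms bounded_linear_zero by (rule param_energy_quadratic)
  moreover have "load (\<lambda>_. 0) \<phi> x = 0"
    by (simp add: load_def vec_eq_iff)
  ultimately show ?thesis
    by (simp add: param_energy_def energy_def)
qed

text \<open>
  A linear dependence would be an eigenvector of the Gram matrix for the eigenvalue \<open>0\<close>. All
  eigenvalues of a Gram matrix are nonnegative, so \<open>0\<close> would be the smallest one.
\<close>

lemma gram_lambda_min_pos_imp_independent:
  fixes \<phi> :: "'x \<Rightarrow> 'u::real_inner ^ 'l"
  assumes pos: "0 < lambda_min (gram \<phi> x)" and v: "v \<noteq> 0"
  shows "realization \<phi> v x \<noteq> 0"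
proof
  assume R: "realization \<phi> v x = 0"
  have gram_form: "u \<bullet> (gram \<phi> x *v u) = (norm (realization \<phi> u x))\<^sup>2" for u
    using stiffness_quadratic_form[OF bounded_bilinear_inner, of u \<phi> x]
    by (simp add: gram_def stiffness_def power2_norm_eq_inner)
  have "gram \<phi> x *v v = 0"
  proof (rule vec_eq_iff[THEN iffD2], rule allI)
    fix i
    have "(gram \<phi> x *v v) $ i = realization \<phi> v x \<bullet> (\<phi> x $ i)"
      by (simp add: gram_def matrix_vector_mult_def realization_def inner_sum_left mult.commute)
    then show "(gram \<phi> x *v v) $ i = 0 $ i"
      by (simp add: R)
  qed
  then have "gram \<phi> x *v v = 0 *\<^sub>R v"
    by (simp only: scaleR_zero_left)
  with v have "\<exists>u. u \<noteq> 0 \<and> gram \<phi> x *v u = 0 *\<^sub>R u"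
    by (intro exI conjI)
  moreover have "0 \<le> c" if eigen: "\<exists>u. u \<noteq> 0 \<and> gram \<phi> x *v u = c *\<^sub>R u" for c
  proof -
    obtain u where u: "u \<noteq> 0" "gram \<phi> x *v u = c *\<^sub>R u"
      using eigen by blast
    have "c * (u \<bullet> u) = (norm (realization \<phi> u x))\<^sup>2"
      using gram_form[of u] u(2) by simp
    then have "0 \<le> c * (u \<bullet> u)"
      by simp
    then show ?thesis
      using u(1) by (simp add: zero_le_mult_iff flip: power2_norm_eq_inner)
  qed
  ultimately have "lambda_min (gram \<phi> x) = 0"
    unfolding lambda_min_def by (rule Least_equality)
  then show False
    using pos by simp
qed

lemma transpose_stiffness:
  assumes "\<And>u v. a u v = a v u"
  shows "transpose (stiffness a \<phi> x) = stiffness a \<phi> x"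
  using assms by (simp add: stiffness_def transpose_def vec_eq_iff)

lemma differentiable_vec_componentwise:
  fixes f :: "'x::real_normed_vector \<Rightarrow> 'b::euclidean_space ^ 'l"
  shows "f differentiable (at x) \<longleftrightarrow> (\<forall>i. (\<lambda>y. f y $ i) differentiable (at x))"
proof
  assume "f differentiable (at x)"
  then show "\<forall>i. (\<lambda>y. f y $ i) differentiable (at x)"
    unfolding differentiable_def
    using bounded_linear.has_derivative[OF bounded_linear_vec_nth] by blast
next
  assume "\<forall>i. (\<lambda>y. f y $ i) differentiable (at x)"
  then show "f differentiable (at x)"
    by (subst differentiable_componentwise_within)
      (auto simp: Basis_vec_def inner_axis intro!: differentiable_inner)
qed

lemma realization_add: "realization \<phi> (v + w) x = realization \<phi> v x + realization \<phi> w x"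
  by (simp add: realization_def scaleR_left_distrib sum.distrib)

lemma realization_axis: "realization \<phi> (axis i 1) x = \<phi> x $ i"
  by (simp add: realization_def axis_def if_distrib[of "\<lambda>c. c *\<^sub>R _"] cong: if_cong)

text \<open>
  Differentiability is known for the parametric energies, not for the basis functions. The entries
  of the stiffness matrix and of the load vector are combinations of finitely many energies, by
  polarisation: the second difference of the energy at \<open>0\<close> along two unit vectors is an entry of
  the stiffness matrix.
\<close>

lemma
  fixes a :: "'u::real_normed_vector \<Rightarrow> 'u \<Rightarrow> real"
    and \<phi> :: "'x::real_normed_vector \<Rightarrow> 'u ^ 'l"
  assumes a: "bounded_bilinear a" "\<And>u v. a u v = a v u" and l: "bounded_linear l"
    and diff: "\<And>v. (\<lambda>y. param_energy a l \<phi> v y) differentiable (at x)"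
  shows stiffness_differentiable: "stiffness a \<phi> differentiable (at x)"
    and load_differentiable: "load l \<phi> differentiable (at x)"
proof -
  interpret a: bounded_bilinear a by fact
  interpret l: bounded_linear l by fact
  have coeff: "stiffness a \<phi> y $ i $ j = param_energy a l \<phi> (axis i 1 + axis j 1) y
      - param_energy a l \<phi> (axis i 1) y - param_energy a l \<phi> (axis j 1) y" for y i j
    by (simp add: stiffness_def param_energy_def energy_def realization_add realization_axis
        a.add_left a.add_right l.add a(2)[of "\<phi> y $ j" "\<phi> y $ i"] field_simps)
  have entry: "(\<lambda>y. stiffness a \<phi> y $ i $ j) differentiable (at x)" for i j
    unfolding coeff by (intro differentiable_diff diff)
  show "stiffness a \<phi> differentiable (at x)"
    unfolding differentiable_vec_componentwise using entry by blast
  have "load l \<phi> y $ j = stiffness a \<phi> y $ j $ j / 2 - param_energy a l \<phi> (axis j 1) y" for y j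
    by (simp add: stiffness_def load_def param_energy_def energy_def realization_axis)
  then show "load l \<phi> differentiable (at x)"
    unfolding differentiable_vec_componentwise
    using entry diff by (auto intro!: differentiable_diff differentiable_divide)
qed

text \<open>
  The quadratic polynomial \<open>\<alpha> / 2 * t\<^sup>2 - K * t\<close> in \<open>t = norm u\<close> is bounded below, where \<open>K\<close>
  bounds the linear form. It ensures that the infimum in \<open>min_energy\<close> is a lower bound.
\<close>

lemma energy_bounded_below:
  fixes a :: "'u::real_normed_vector \<Rightarrow> 'u \<Rightarrow> real"
  assumes "0 < \<alpha>" "\<And>u. \<alpha> * (norm u)\<^sup>2 \<le> a u u" and l: "bounded_linear l"
  shows "\<exists>m. \<forall>u. m \<le> energy a l u"
proof -
  obtain K where K: "\<And>u. norm (l u) \<le> norm u * K"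
    using bounded_linear.pos_bounded[OF l] by blast
  have "- (K\<^sup>2 / (2 * \<alpha>)) \<le> energy a l u" for u
  proof -
    have "0 \<le> (\<alpha> * norm u - K)\<^sup>2 / (2 * \<alpha>)"
      using assms(1) by simp
    also have "\<dots> = \<alpha> * (norm u)\<^sup>2 / 2 - norm u * K + K\<^sup>2 / (2 * \<alpha>)"
      using assms(1) by (simp add: power2_eq_square field_simps)
    finally show ?thesis
      using assms(2)[of u] K[of u] unfolding energy_def by (simp add: abs_le_iff)
  qed
  then show ?thesis
    by blast
qed

lemma min_energy_le_reduced_energy:
  fixes a :: "'u::real_normed_vector \<Rightarrow> 'u \<Rightarrow> real"
  assumes "0 < \<alpha>" "\<And>u. \<alpha> * (norm u)\<^sup>2 \<le> a u u" "bounded_linear l" and x: "x \<in> X"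
  shows "min_energy a l \<phi> X \<le> reduced_energy a l \<phi> x"
proof -
  obtain m where "\<And>u. m \<le> energy a l u"
    using energy_bounded_below[of \<alpha> a l, OF assms(1-3)] by blast
  then have "bdd_below ((\<lambda>(w, \<xi>). param_energy a l \<phi> w \<xi>) ` (UNIV \<times> X))"
    by (intro bdd_belowI2[where m = m]) (auto simp: param_energy_def)
  then have "min_energy a l \<phi> X \<le> (\<lambda>(w, \<xi>). param_energy a l \<phi> w \<xi>) (w_best a l \<phi> x, x)"
    unfolding min_energy_def using x by (intro cINF_lower) auto
  then show ?thesis
    by (simp add: reduced_energy_def)
qed

text \<open>
  The update of the nonlinear parameters at frozen linear parameters thus uses the gradient of the
  reduced energy itself.
\<close>

lemma GDERIV_reduced_energy:
  fixes a :: "'u::real_inner \<Rightarrow> 'u \<Rightarrow> real" and \<phi> :: "'x::euclidean_space \<Rightarrow> 'u ^ 'l"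
  assumes a: "bounded_bilinear a" "\<And>u v. a u v = a v u"
    and coercive: "0 < \<alpha>" "\<And>u. \<alpha> * (norm u)\<^sup>2 \<le> a u u"
    and l: "bounded_linear l"
    and gram: "0 < lambda_min (gram \<phi> x)"
    and diff: "\<And>v. param_energy a l \<phi> v differentiable (at x)"
  shows "GDERIV (reduced_energy a l \<phi>) x :> grad (param_energy a l \<phi> (w_best a l \<phi> x)) x"
proof -
  note K = param_energy_eq_quadratic_energy[OF a(1) l, of \<phi>]
  have "0 < v \<bullet> (stiffness a \<phi> x *v v)" if "v \<noteq> 0" for v
  proof -
    have "0 < \<alpha> * (norm (realization \<phi> v x))\<^sup>2"
      using gram_lambda_min_pos_imp_independent[OF gram that] coercive(1) by simp
    also have "\<dots> \<le> v \<bullet> (stiffness a \<phi> x *v v)"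
      unfolding stiffness_quadratic_form[OF a(1)] by (rule coercive(2))
    finally show ?thesis .
  qed
  moreover have "GDERIV (\<lambda>y. quadratic_energy (stiffness a \<phi> y) (load l \<phi> y) (w_best a l \<phi> x)) x
      :> grad (param_energy a l \<phi> (w_best a l \<phi> x)) x"
    using GDERIV_grad[OF diff] unfolding K .
  ultimately have "GDERIV (\<lambda>y. quadratic_energy (stiffness a \<phi> y) (load l \<phi> y) (w_best a l \<phi> y)) x
      :> grad (param_energy a l \<phi> (w_best a l \<phi> x)) x"
    unfolding w_best_def
    by (rule envelope_quadratic_energy[OF stiffness_differentiable[of a l, OF a l diff]
          load_differentiable[of a l, OF a l diff] transpose_stiffness[of a, OF a(2)]])
  then show ?thesis
    unfolding K[symmetric] reduced_energy_def[symmetric] .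
qed

theorem lemma5:
  fixes a :: "'u::{real_inner, complete_space} \<Rightarrow> 'u \<Rightarrow> real"
    and l :: "'u \<Rightarrow> real"
    and \<phi> :: "real ^ 'n \<Rightarrow> 'u ^ 'l"
    and X :: "(real ^ 'n) set"
    and B :: "real ^ 'n \<Rightarrow> real ^ 'n \<Rightarrow> real"
    and \<psi> :: "real ^ 'n \<Rightarrow> real"
    and \<xi> :: "nat \<Rightarrow> real ^ 'n"
    and w :: "nat \<Rightarrow> real ^ 'l"
    and \<gamma> :: "nat \<Rightarrow> real"
    and \<alpha> \<omega>min \<mu> \<rho> Lred :: real
  defines "Kred \<equiv> reduced_energy a l \<phi>"
    and "Kstar \<equiv> min_energy a l \<phi> X"
    and "\<delta> \<equiv> bregman_dist \<psi> (best_params a l \<phi> X)"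
    and "\<Lambda> \<equiv> bregman_nbhd \<psi> (best_params a l \<phi> X) X"
  assumes a: "bounded_bilinear a" "\<And>u v. a u v = a v u"
    and coercive: "\<alpha> > 0" "\<And>u. a u u \<ge> \<alpha> * (norm u)\<^sup>2"
    and l: "bounded_linear l"
    and X: "X \<noteq> {}" "convex X" "compact X"
    and B: "is_inner_product B"
    and \<psi>: "twice_differentiable_near \<psi> X" "\<mu> > 0" "strongly_convex_wrt B \<mu> X \<psi>"
    and gram: "\<omega>min > 0" "\<And>x. x \<in> X \<Longrightarrow> lambda_min (gram \<phi> x) \<ge> \<omega>min"
    and K_diff: "\<And>v. differentiable_near (param_energy a l \<phi> v) X"
    and dir_convex: "\<rho> > 0" "directionally_convex_on \<psi> (best_params a l \<phi> X) Kred (\<Lambda> \<rho>)"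
    and Lipschitz: "Lred > 0"
      "\<And>x y. x \<in> X \<Longrightarrow> y \<in> X \<Longrightarrow>
         dual_norm B (grad Kred x - grad Kred y) \<le> Lred * ip_norm B (x - y)"
    and init: "\<xi> 0 \<in> \<Lambda> \<rho>"
    and linear_update: "\<And>k. w k = w_best a l \<phi> (\<xi> k)"
    and nonlinear_update: "\<And>k. is_arg_min
         (\<lambda>\<eta>. \<gamma> k * (grad (param_energy a l \<phi> (w k)) (\<xi> k) \<bullet> \<eta>) + bregman \<psi> \<eta> (\<xi> k))
         (\<lambda>\<eta>. \<eta> \<in> X) (\<xi> (Suc k))"
    and steps: "\<And>k. \<gamma> k > 0" "\<And>k. \<gamma> k \<le> \<mu> / Lred"
  shows "(\<forall>k. \<delta> (\<xi> (Suc k)) \<le> \<delta> (\<xi> k)) \<and> (\<forall>k. \<xi> k \<in> \<Lambda> (\<delta> (\<xi> 0))) \<and>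
         (\<forall>n\<ge>1. Kred (\<xi> n) \<le> Kstar + \<delta> (\<xi> 0) / (\<Sum>k<n. \<gamma> k))"
proof -
  have GK: "GDERIV Kred x :> grad (param_energy a l \<phi> (w_best a l \<phi> x)) x" if "x \<in> X" for x
    unfolding Kred_def
    by (rule GDERIV_reduced_energy[of a \<alpha> l, OF a coercive l])
      (use gram(1) gram(2)[OF that] differentiable_near_imp_GDERIV(1)[OF K_diff that] in auto)
  have grad_Kred: "grad Kred x = grad (param_energy a l \<phi> (w_best a l \<phi> x)) x" if "x \<in> X" for x
    using GK[OF that] by (rule grad_eqI)
  have in_X: "\<xi> k \<in> X" for k
    using init nonlinear_update[of "k - 1"]
    by (cases k) (auto simp: \<Lambda>_def bregman_nbhd_def is_arg_min_def)
  have "differentiable_near \<psi> X"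
    using \<psi>(1) unfolding twice_differentiable_near_def differentiable_near_def by blast
  then have G\<psi>: "GDERIV \<psi> x :> grad \<psi> x" if "x \<in> X" for x
    using that by (rule differentiable_near_imp_GDERIV(2))
  have S: "best_params a l \<phi> X \<subseteq> X" "\<And>s. s \<in> best_params a l \<phi> X \<Longrightarrow> Kred s = Kstar"
    by (auto simp: best_params_def Kred_def Kstar_def)
  have Kstar_le: "Kstar \<le> Kred x" if "x \<in> X" for x
    unfolding Kstar_def Kred_def by (rule min_energy_le_reduced_energy[of \<alpha> a l, OF coercive l that])
  have GKred: "GDERIV Kred x :> grad Kred x" if "x \<in> X" for x
    using GK[OF that] grad_Kred[OF that] by simp
  have update: "is_arg_min (\<lambda>\<eta>. \<gamma> k * (grad Kred (\<xi> k) \<bullet> \<eta>) + bregman \<psi> \<eta> (\<xi> k))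
      (\<lambda>\<eta>. \<eta> \<in> X) (\<xi> (Suc k))" for k
    using nonlinear_update[of k] by (simp add: grad_Kred[OF in_X] linear_update)
  note rate = mirror_descent_directional_convexity[OF B X(2) S Kstar_le GKred Lipschitz(2) G\<psi> \<psi>(2,3)
      dir_convex(2)[unfolded \<Lambda>_def] init[unfolded \<Lambda>_def] Lipschitz(1) steps update]
  show ?thesis
    using rate unfolding \<delta>_def \<Lambda>_def by blast
qed

end
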